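(* For every topological space $X$: if $X$ is Hausdorff ($T_2$) then $X$ is UR; and if $X$ is UR then $X$ is UOK.
   Context: No separation axioms are assumed unless stated. A transfinite sequence in $X$ is a function $f:\lambda\to X$ (not necessarily continuous) from some limit ordinal $\lambda$ into $X$. A point $x\in X$ is a limit of $f$ if for every neighborhood $U$ of $x$ there is $\beta<\lambda$ with $f(\gamma)\in U$ for all $\gamma$ with $\beta\leq\gamma<\lambda$. A space $X$ is UR if every transfinite sequence in $X$ has at most one limit. A space $X$ is UOK if for every non-compact, locally compact Hausdorff space $L$ and every continuous function $f:L\to X$, there exists at most one continuous extension $\hat f:\hat L\to X$ of $f$, where $\hat L=L\cup\{\infty\}$ is the one-point compactification of $L$. *)

theory Defs
  imports "HOL-Analysis.Analysis"
begin

text \<open>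
  A limit ordinal is represented by a nonempty well-order without a last element on a subset
  (its field) of a type. The ordinal 0 is left out: a sequence of length 0 has no limits.
\<close>

definition limit_well_order :: "'i rel \<Rightarrow> bool" where
  "limit_well_order r \<longleftrightarrow>
     Well_order r \<and> Field r \<noteq> {} \<and> (\<forall>i\<in>Field r. \<exists>j\<in>Field r. (i, j) \<in> r \<and> j \<noteq> i)"

definition transfinite_seq :: "'a topology \<Rightarrow> 'i rel \<Rightarrow> ('i \<Rightarrow> 'a) \<Rightarrow> bool" where
  "transfinite_seq X r f \<longleftrightarrow> limit_well_order r \<and> f \<in> Field r \<rightarrow> topspace X"

definition transfinite_limit :: "'a topology \<Rightarrow> 'i rel \<Rightarrow> ('i \<Rightarrow> 'a) \<Rightarrow> 'a \<Rightarrow> bool" where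
  "transfinite_limit X r f x \<longleftrightarrow> x \<in> topspace X \<and>
     (\<forall>U. openin X U \<and> x \<in> U \<longrightarrow>
       (\<exists>\<beta>\<in>Field r. \<forall>\<gamma>\<in>Field r. (\<beta>, \<gamma>) \<in> r \<longrightarrow> f \<gamma> \<in> U))"

text \<open>
  HOL cannot quantify over types inside a formula, so the type \<open>'i\<close> carrying the ordinals is a
  parameter. The lemma \<open>UR_type_independent\<close> below shows that \<open>'i = 'a + nat\<close>, where \<open>'a\<close> is the
  type of points, already accounts for the limit ordinals carried by arbitrary types. Thus
  \<open>UR TYPE('a + nat) X\<close> is the unrestricted property.
\<close>

definition UR :: "'i itself \<Rightarrow> 'a topology \<Rightarrow> bool" where
  "UR _ X \<longleftrightarrow>
     (\<forall>(r :: 'i rel) f x y. transfinite_seq X r f \<longrightarrow>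
        transfinite_limit X r f x \<longrightarrow> transfinite_limit X r f y \<longrightarrow> x = y)"

text \<open>
  The type \<open>'l\<close> of points of \<open>L\<close> is likewise a parameter. In the library's
  \<open>Alexandroff_compactification L\<close> a point \<open>z\<close> of \<open>L\<close> appears as \<open>Some z\<close>, and \<open>None\<close> is the
  point at infinity. Functions are total in HOL, so two extensions count as equal if they
  agree on the compactification.
\<close>

definition UOK :: "'l itself \<Rightarrow> 'a topology \<Rightarrow> bool" where
  "UOK _ X \<longleftrightarrow>
     (\<forall>(L :: 'l topology) f. \<not> compact_space L \<longrightarrow> locally_compact_space L \<longrightarrow>
        Hausdorff_space L \<longrightarrow> continuous_map L X f \<longrightarrow>
        (\<forall>g h. continuous_map (Alexandroff_compactification L) X g \<longrightarrow>
               continuous_map (Alexandroff_compactification L) X h \<longrightarrow>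
               (\<forall>z\<in>topspace L. g (Some z) = f z) \<longrightarrow>
               (\<forall>z\<in>topspace L. h (Some z) = f z) \<longrightarrow>
               (\<forall>w\<in>topspace (Alexandroff_compactification L). g w = h w)))"

lemma Field_Restr_Well_order:
  assumes "Well_order r" "C \<subseteq> Field r"
  shows "Field (Restr r C) = C"
  using assms Refl_Field_Restr2[of r C]
  by (auto simp: order_on_defs)

lemma transfinite_limit_dir_image:
  assumes wo: "Well_order r" and sub: "C \<subseteq> Field r" and inj: "inj_on t C"
    and cof: "\<And>i. i \<in> Field r \<Longrightarrow> \<exists>c\<in>C. (i, c) \<in> r"
    and f': "\<And>c. c \<in> C \<Longrightarrow> f' (t c) = f c"
    and lim: "transfinite_limit X r f x"
  shows "transfinite_limit X (dir_image (Restr r C) t) f' x"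
proof -
  let ?q = "dir_image (Restr r C) t"
  have Fq: "Field ?q = t ` C"
    by (simp add: dir_image_Field Field_Restr_Well_order[OF wo sub])
  have tr: "trans r" using wo by (auto simp: order_on_defs)
  have q: "(c, d) \<in> r" if "c \<in> C" "d \<in> C" "(t c, t d) \<in> ?q" for c d
    using that inj unfolding dir_image_def inj_on_def by auto
  have "\<exists>\<beta>\<in>Field ?q. \<forall>\<gamma>\<in>Field ?q. (\<beta>, \<gamma>) \<in> ?q \<longrightarrow> f' \<gamma> \<in> U"
    if U: "openin X U" "x \<in> U" for U
  proof -
    obtain b where b: "b \<in> Field r" "\<And>c. c \<in> Field r \<Longrightarrow> (b, c) \<in> r \<Longrightarrow> f c \<in> U"
      using lim U unfolding transfinite_limit_def by blast
    obtain c where c: "c \<in> C" "(b, c) \<in> r" using cof b(1) by blast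
    have "f' (t d) \<in> U" if "d \<in> C" "(t c, t d) \<in> ?q" for d
      using b(2)[of d] q[OF c(1) that] that(1) f' sub c(2) tr by (metis subsetD transD)
    then show ?thesis using c(1) unfolding Fq by blast
  qed
  then show ?thesis using lim unfolding transfinite_limit_def by blast
qed

lemma UR_type_independent:
  fixes X :: "'a topology"
  assumes UR: "UR TYPE('a + nat) X"
  shows "UR TYPE('i) X"
  unfolding UR_def
proof (intro allI impI)
  fix r :: "'i rel" and f x y
  assume seq: "transfinite_seq X r f"
    and lx: "transfinite_limit X r f x" and ly: "transfinite_limit X r f y"
  have wo: "Well_order r" and ne: "Field r \<noteq> {}"
    and nomax: "\<And>i. i \<in> Field r \<Longrightarrow> \<exists>j\<in>Field r. (i, j) \<in> r \<and> j \<noteq> i"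
    and fX: "\<And>i. i \<in> Field r \<Longrightarrow> f i \<in> topspace X"
    using seq unfolding transfinite_seq_def limit_well_order_def by auto
  have tr: "trans r" and anti: "antisym r"
    using wo by (simp_all add: order_on_defs)
  have tot: "(i, j) \<in> r \<or> (j, i) \<in> r" if "i \<in> Field r" "j \<in> Field r" for i j
    using wo that by (cases "i = j") (auto simp: order_on_defs refl_on_def total_on_def)
  show "x = y"
  proof (cases "\<exists>a. \<forall>i\<in>Field r. \<exists>j\<in>Field r. (i, j) \<in> r \<and> f j = a")
    case True
    then obtain a where a: "\<And>i. i \<in> Field r \<Longrightarrow> \<exists>j\<in>Field r. (i, j) \<in> r \<and> f j = a" by blast
    let ?q = "dir_image natLeq (Inr :: nat \<Rightarrow> 'a + nat)"
    have Fq: "Field ?q = range Inr"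
      by (simp add: dir_image_Field Field_natLeq)
    have aX: "a \<in> topspace X" using a ne fX by blast
    have wq: "Well_order ?q" by (rule Well_order_dir_image[OF natLeq_Well_order]) auto
    have "\<exists>j\<in>Field ?q. (i, j) \<in> ?q \<and> j \<noteq> i" if i: "i \<in> Field ?q" for i
    proof -
      obtain n where n: "i = Inr n" using i Fq by blast
      have "(i, Inr (Suc n)) \<in> ?q" unfolding n dir_image_def natLeq_def by auto
      moreover have "Inr (Suc n) \<noteq> i" using n by simp
      moreover have "Inr (Suc n) \<in> Field ?q" unfolding Fq by (rule rangeI)
      ultimately show ?thesis by (intro bexI[of _ "Inr (Suc n)"] conjI)
    qed
    then have sq: "transfinite_seq X ?q (\<lambda>_. a)"
      using wq Fq aX unfolding transfinite_seq_def limit_well_order_def by auto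
    have "transfinite_limit X ?q (\<lambda>_. a) z" if lz: "transfinite_limit X r f z" for z
    proof -
      have "a \<in> U" if "openin X U" "z \<in> U" for U
        using lz that a unfolding transfinite_limit_def by metis
      then show ?thesis using lz Fq unfolding transfinite_limit_def by auto
    qed
    then show ?thesis using UR sq lx ly unfolding UR_def by blast
  next
    case False
    then have "\<forall>a. \<exists>i\<in>Field r. \<forall>j\<in>Field r. f j = a \<longrightarrow> (i, j) \<notin> r" by blast
    then obtain s where s: "\<And>a. s a \<in> Field r"
      "\<And>a j. j \<in> Field r \<Longrightarrow> f j = a \<Longrightarrow> (s a, j) \<notin> r" by metis
    define C where "C = range s"
    have sub: "C \<subseteq> Field r" unfolding C_def using s(1) by blast
    have cof: "\<exists>c\<in>C. (i, c) \<in> r" if "i \<in> Field r" for i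
      using s(1)[of "f i"] s(2)[OF that HOL.refl] that tot unfolding C_def by blast
    define t :: "'i \<Rightarrow> 'a + nat" where "t c = Inl (inv s c)" for c
    have inj: "inj_on t C" unfolding t_def C_def
      by (rule inj_onI) (metis Inl_inject f_inv_into_f)
    let ?q = "dir_image (Restr r C) t"
    define f' where "f' k = f (inv_into C t k)" for k
    have f': "f' (t c) = f c" if "c \<in> C" for c
      using inv_into_f_f[OF inj that] by (simp add: f'_def)
    have FR: "Field (Restr r C) = C" by (rule Field_Restr_Well_order[OF wo sub])
    have Fq: "Field ?q = t ` C" by (simp add: dir_image_Field FR)
    have wq: "Well_order ?q"
      using Well_order_dir_image[OF Well_order_Restr[OF wo]] inj FR by metis
    have lim: "transfinite_limit X ?q f' z" if "transfinite_limit X r f z" for z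
      by (rule transfinite_limit_dir_image[OF wo sub inj cof f' that])
    have neq: "Field ?q \<noteq> {}" using Fq ne cof by blast
    have rng: "f' \<in> Field ?q \<rightarrow> topspace X" unfolding Fq using f' fX sub by auto
    have "\<exists>j\<in>Field ?q. (i, j) \<in> ?q \<and> j \<noteq> i" if "i \<in> Field ?q" for i
    proof -
      have "i \<in> t ` C" using that by (simp only: Fq)
      then obtain c where c: "c \<in> C" "i = t c" by blast
      obtain j where j: "j \<in> Field r" "(c, j) \<in> r" "j \<noteq> c" using nomax c(1) sub by blast
      obtain d where d: "d \<in> C" "(j, d) \<in> r" using cof j(1) by blast
      have cd: "(c, d) \<in> r" using j d tr by (meson transD)
      have "d \<noteq> c" using j d anti by (meson antisymD)
      then have "t d \<noteq> t c" using inj c d by (meson inj_onD)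
      moreover have "(t c, t d) \<in> ?q" using cd c(1) d(1) unfolding dir_image_def by auto
      moreover have "t d \<in> Field ?q" unfolding Fq using d(1) by (rule imageI)
      ultimately show ?thesis unfolding c(2) by (intro bexI[of _ "t d"] conjI)
    qed
    then have "transfinite_seq X ?q f'"
      using wq neq rng unfolding transfinite_seq_def limit_well_order_def by blast
    then show ?thesis using UR lim[OF lx] lim[OF ly] unfolding UR_def by blast
  qed
qed

end

(* For UR implies UOK, take an open cover of minimal cardinality among those without finite subcover,
   well-ordered with order type that cardinal. By minimality no proper initial segment covers,
   so one can pick z u outside every member preceding u. This sequence eventually leaves each
   member of the cover, hence each compact set: in the one-point compactification it converges
   to infinity. Its image under f then converges to the values of both extensions at infinity. *)
theory Submission
  imports Defs
begin

lemma Hausdorff_space_imp_UR: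
  assumes "Hausdorff_space X"
  shows "UR TYPE('i) X"
  unfolding UR_def
proof (intro allI impI)
  fix r :: "'i rel" and f x y
  assume seq: "transfinite_seq X r f"
    and lx: "transfinite_limit X r f x" and ly: "transfinite_limit X r f y"
  have wo: "Well_order r"
    using seq unfolding transfinite_seq_def limit_well_order_def by auto
  have total: "(i, j) \<in> r \<or> (j, i) \<in> r" and refl: "(i, i) \<in> r"
    if "i \<in> Field r" "j \<in> Field r" for i j
    using wo that by (cases "i = j"; auto simp: order_on_defs refl_on_def total_on_def)+
  show "x = y"
  proof (rule ccontr)
    assume "x \<noteq> y"
    moreover have "x \<in> topspace X" "y \<in> topspace X"
      using lx ly by (auto simp: transfinite_limit_def)
    ultimately obtain U V where
      UV: "openin X U" "openin X V" "x \<in> U" "y \<in> V" "disjnt U V"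
      using assms unfolding Hausdorff_space_def by metis
    obtain b where b: "b \<in> Field r" "\<And>c. c \<in> Field r \<Longrightarrow> (b, c) \<in> r \<Longrightarrow> f c \<in> U"
      using lx UV unfolding transfinite_limit_def by metis
    obtain d where d: "d \<in> Field r" "\<And>c. c \<in> Field r \<Longrightarrow> (d, c) \<in> r \<Longrightarrow> f c \<in> V"
      using ly UV unfolding transfinite_limit_def by metis
    \<comment> \<open>The later of \<open>b\<close> and \<open>d\<close> lies beyond both
      thresholds, so its value falls into both sets.\<close>
    have "\<exists>c. f c \<in> U \<and> f c \<in> V"
      using b d total refl by meson
    then show False using UV(5) by (auto simp: disjnt_iff)
  qed
qed

text \<open>The minimum exists because \<open>ordLess\<close> is well-founded. It is taken over all
  open covers without finite subcover, and then used only for subfamilies of the chosen one.\<close>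

lemma not_compact_space_minimal_cover:
  assumes "\<not> compact_space L"
  obtains \<U> where "\<And>U. U \<in> \<U> \<Longrightarrow> openin L U" "\<Union>\<U> = topspace L"
    "\<And>\<V>. finite \<V> \<Longrightarrow> \<V> \<subseteq> \<U> \<Longrightarrow> \<Union>\<V> \<noteq> topspace L"
    "\<And>\<V>. \<V> \<subseteq> \<U> \<Longrightarrow> (card_of \<V>, card_of \<U>) \<in> ordLess \<Longrightarrow> \<Union>\<V> \<noteq> topspace L"
proof -
  define bad where "bad \<U> \<longleftrightarrow> (\<forall>U\<in>\<U>. openin L U) \<and> \<Union>\<U> = topspace L \<and>
      \<not> (\<exists>\<V>. finite \<V> \<and> \<V> \<subseteq> \<U> \<and> \<Union>\<V> = topspace L)" for \<U>
  obtain \<U>0 where "bad \<U>0"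
    using assms unfolding compact_space bad_def by (metis (no_types, lifting))
  then obtain \<U> where bad: "bad \<U>"
    and min: "\<And>\<V>. (card_of \<V>, card_of \<U>) \<in> ordLess \<Longrightarrow> \<not> bad \<V>"
    using wfE_min[OF wf_inv_image[OF wf_ordLess, of card_of], of \<U>0 "Collect bad"]
    by (auto simp: inv_image_def)
  show thesis
  proof (rule that)
    \<comment> \<open>If \<open>\<V>\<close> covered, it would inherit openness and the lack of a
      finite subcover from \<open>\<U>\<close>, so it would be a bad family of smaller
      cardinality.\<close>
    fix \<V> assume "\<V> \<subseteq> \<U>" "(card_of \<V>, card_of \<U>) \<in> ordLess"
    then show "\<Union>\<V> \<noteq> topspace L"
      using bad min[of \<V>] unfolding bad_def by (meson subset_iff)
  qed (use bad in \<open>auto simp: bad_def\<close>)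
qed

text \<open>The index ordinal is carried by the open cover itself, which is why its type is
  \<open>'l set\<close>.\<close>

lemma not_compact_space_transfinite_seq:
  fixes L :: "'l topology"
  assumes "\<not> compact_space L"
  obtains r :: "'l set rel" and z where "transfinite_seq L r z"
    "\<And>K. compactin L K \<Longrightarrow>
       \<exists>\<beta>\<in>Field r. \<forall>\<gamma>\<in>Field r. (\<beta>, \<gamma>) \<in> r \<longrightarrow> z \<gamma> \<notin> K"
proof -
  obtain \<U> where opn: "\<And>U. U \<in> \<U> \<Longrightarrow> openin L U" and cover: "\<Union>\<U> = topspace L"
    and nofin: "\<And>\<V>. finite \<V> \<Longrightarrow> \<V> \<subseteq> \<U> \<Longrightarrow> \<Union>\<V> \<noteq> topspace L"
    and small: "\<And>\<V>. \<V> \<subseteq> \<U> \<Longrightarrow> (card_of \<V>, card_of \<U>) \<in> ordLess \<Longrightarrow> \<Union>\<V> \<noteq> topspace L"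
    using not_compact_space_minimal_cover[OF assms] by metis
  \<comment> \<open>This well-order on \<open>\<U>\<close> has the cardinal of \<open>\<U>\<close>
    as order type. Hence its proper initial segments have smaller cardinality, so
    \<open>small\<close> applies to them, and as \<open>\<U>\<close> is infinite there is no last
    element.\<close>
  define r where "r = card_of \<U>"
  have F: "Field r = \<U>" and co: "Card_order r" and wo: "Well_order r"
    unfolding r_def by (rule Field_card_of card_of_Card_order card_of_Well_order)+
  have tr: "trans r" and anti: "antisym r"
    using wo by (simp_all add: order_on_defs)
  have total: "(i, j) \<in> r \<or> (j, i) \<in> r" if "i \<in> \<U>" "j \<in> \<U>" for i j
    using wo that F by (cases "i = j") (auto simp: order_on_defs refl_on_def total_on_def)
  have inf: "infinite \<U>"
    using nofin cover by blast
  have nomax: "\<exists>j\<in>\<U>. i \<noteq> j \<and> (i, j) \<in> r" if "i \<in> \<U>" for i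
    using infinite_Card_order_limit[OF co] inf that F by metis
  have "\<exists>p. p \<in> topspace L \<and> p \<notin> \<Union>(underS r u)" if u: "u \<in> \<U>" for u
  proof -
    have sub: "underS r u \<subseteq> \<U>"
      using F by (auto simp: underS_def Field_def)
    have "(card_of (underS r u), r) \<in> ordLess"
      using card_of_underS[OF co] u F by simp
    then have "\<Union>(underS r u) \<noteq> topspace L"
      using small[OF sub] by (simp add: r_def)
    then show ?thesis using sub cover by blast
  qed
  then obtain z where z: "\<And>u. u \<in> \<U> \<Longrightarrow> z u \<in> topspace L"
    "\<And>u v. u \<in> \<U> \<Longrightarrow> (v, u) \<in> r \<Longrightarrow> v \<noteq> u \<Longrightarrow> z u \<notin> v"
    unfolding underS_def by (metis (mono_tags, lifting) UnionI mem_Collect_eq)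
  \<comment> \<open>A compact set lies in the union of finitely many members of \<open>\<U>\<close>,
    so it suffices to leave such unions.\<close>
  have leave: "\<exists>\<beta>\<in>\<U>. \<forall>\<gamma>\<in>\<U>. (\<beta>, \<gamma>) \<in> r \<longrightarrow> z \<gamma> \<notin> \<Union>\<V>"
    if "finite \<V>" "\<V> \<subseteq> \<U>" for \<V>
    using that
  proof (induction \<V>)
    case empty
    have "\<U> \<noteq> {}" using inf by auto
    then show ?case by auto
  next
    case (insert v \<V>)
    have "\<V> \<subseteq> \<U>" using insert.prems by simp
    from insert.IH[OF this] obtain b where
      b: "b \<in> \<U>" "\<forall>c\<in>\<U>. (b, c) \<in> r \<longrightarrow> z c \<notin> \<Union>\<V>"
      by (rule bexE)
    \<comment> \<open>The threshold must lie strictly above \<open>v\<close>: the choice of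
      \<open>z v\<close> keeps it out of the strict predecessors of \<open>v\<close>, but not out of
      \<open>v\<close> itself.\<close>
    obtain d where d: "d \<in> \<U>" "v \<noteq> d" "(v, d) \<in> r"
      using nomax insert.prems by blast
    have avoid: "z c \<notin> v" if "c \<in> \<U>" "(d, c) \<in> r" for c
    proof (rule z(2)[OF that(1)])
      show "(v, c) \<in> r" using d that tr by (meson transD)
      show "v \<noteq> c" using d that anti by (meson antisymD)
    qed
    \<comment> \<open>\<open>e\<close> is the later of \<open>b\<close> and
      \<open>d\<close>.\<close>
    obtain e where e: "e \<in> \<U>" "\<And>c. (e, c) \<in> r \<Longrightarrow> (b, c) \<in> r \<and> (d, c) \<in> r"
      using total[OF b(1) d(1)] b(1) d(1) tr by (meson transD)
    show ?case
    proof (intro bexI[OF _ e(1)] ballI impI)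
      fix c assume "c \<in> \<U>" "(e, c) \<in> r"
      then show "z c \<notin> \<Union>(insert v \<V>)" using e(2) b(2) avoid by (metis Union_insert UnE)
    qed
  qed
  show thesis
  proof (rule that)
    have "\<U> \<noteq> {}" using inf by auto
    moreover have "\<forall>i\<in>\<U>. \<exists>j\<in>\<U>. (i, j) \<in> r \<and> j \<noteq> i" using nomax by metis
    ultimately show "transfinite_seq L r z"
      unfolding transfinite_seq_def limit_well_order_def F
      by (intro conjI Pi_I wo[unfolded F] z(1))
  next
    fix K assume K: "compactin L K"
    then have "K \<subseteq> \<Union>\<U>"
      using cover compactin_subset_topspace by metis
    then obtain \<V> where V: "finite \<V>" "\<V> \<subseteq> \<U>" "K \<subseteq> \<Union>\<V>"
      using compactinD[OF K, of \<U>] opn by metis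
    show "\<exists>\<beta>\<in>Field r. \<forall>\<gamma>\<in>Field r. (\<beta>, \<gamma>) \<in> r \<longrightarrow> z \<gamma> \<notin> K"
      unfolding F using leave[OF V(1,2)] V(3) by (meson subsetD)
  qed
qed

lemma transfinite_limit_continuous_map:
  assumes g: "continuous_map Y X g" and lim: "transfinite_limit Y r f x"
  shows "transfinite_limit X r (g \<circ> f) (g x)"
  unfolding transfinite_limit_def
proof (intro conjI allI impI)
  have x: "x \<in> topspace Y"
    using lim by (simp add: transfinite_limit_def)
  then show "g x \<in> topspace X"
    using g by (auto simp: continuous_map_def)
  fix U assume U: "openin X U \<and> g x \<in> U"
  have "openin Y {y \<in> topspace Y. g y \<in> U}" "x \<in> {y \<in> topspace Y. g y \<in> U}"
    using g U x by (auto simp: continuous_map_def)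
  then obtain b where
    "b \<in> Field r" "\<forall>c\<in>Field r. (b, c) \<in> r \<longrightarrow> f c \<in> {y \<in> topspace Y. g y \<in> U}"
    using lim unfolding transfinite_limit_def by metis
  then show "\<exists>\<beta>\<in>Field r. \<forall>\<gamma>\<in>Field r. (\<beta>, \<gamma>) \<in> r \<longrightarrow> (g \<circ> f) \<gamma> \<in> U"
    by auto
qed

text \<open>Serves to replace \<open>k \<circ> (Some \<circ> z)\<close> by
  \<open>f \<circ> z\<close> for an extension \<open>k\<close> of \<open>f\<close>: equality is
  guaranteed only on the field of \<open>r\<close>, where \<open>z\<close> takes values in
  \<open>topspace L\<close>.\<close>

lemma transfinite_limit_cong:
  assumes "transfinite_limit X r f x" "\<And>i. i \<in> Field r \<Longrightarrow> f i = f' i"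
  shows "transfinite_limit X r f' x"
  using assms unfolding transfinite_limit_def by metis

text \<open>An open set containing \<open>None\<close> omits only the points \<open>Some p\<close>
  with \<open>p\<close> in some compact \<open>K\<close>, so a sequence that leaves \<open>K\<close>
  for good stays in that open set.\<close>

lemma transfinite_limit_Alexandroff_infinity:
  assumes "\<And>K. compactin L K \<Longrightarrow>
       \<exists>\<beta>\<in>Field r. \<forall>\<gamma>\<in>Field r. (\<beta>, \<gamma>) \<in> r \<longrightarrow> z \<gamma> \<notin> K"
    and "transfinite_seq L r z"
  shows "transfinite_limit (Alexandroff_compactification L) r (Some \<circ> z) None"
  unfolding transfinite_limit_def
proof (intro conjI allI impI)
  fix U assume U: "openin (Alexandroff_compactification L) U \<and> None \<in> U"
  then obtain K where K: "compactin L K" "U = insert None (Some ` (topspace L - K))"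
    unfolding openin_Alexandroff_compactification by auto
  have "z i \<in> topspace L" if "i \<in> Field r" for i
    using assms(2) that unfolding transfinite_seq_def by blast
  then show "\<exists>\<beta>\<in>Field r. \<forall>\<gamma>\<in>Field r. (\<beta>, \<gamma>) \<in> r \<longrightarrow> (Some \<circ> z) \<gamma> \<in> U"
    using assms(1)[OF K(1)] unfolding K(2) by auto
qed simp

lemma UR_imp_UOK:
  fixes X :: "'a topology"
  assumes UR: "UR TYPE('l set) X"
  shows "UOK TYPE('l) X"
  unfolding UOK_def
proof (intro allI impI ballI)
  fix L :: "'l topology" and f g h w
  assume nc: "\<not> compact_space L" and f: "continuous_map L X f"
    and g: "continuous_map (Alexandroff_compactification L) X g"
    and h: "continuous_map (Alexandroff_compactification L) X h"
    and gf: "\<forall>z\<in>topspace L. g (Some z) = f z"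
    and hf: "\<forall>z\<in>topspace L. h (Some z) = f z"
    and w: "w \<in> topspace (Alexandroff_compactification L)"
  obtain r :: "'l set rel" and z where seq: "transfinite_seq L r z"
    and leave: "\<And>K. compactin L K \<Longrightarrow>
       \<exists>\<beta>\<in>Field r. \<forall>\<gamma>\<in>Field r. (\<beta>, \<gamma>) \<in> r \<longrightarrow> z \<gamma> \<notin> K"
    using not_compact_space_transfinite_seq[OF nc] by metis
  have z: "z i \<in> topspace L" if "i \<in> Field r" for i
    using seq that unfolding transfinite_seq_def by blast
  have lim: "transfinite_limit (Alexandroff_compactification L) r (Some \<circ> z) None"
    by (rule transfinite_limit_Alexandroff_infinity[OF leave seq])
  \<comment> \<open>Every extension \<open>k\<close> sends the sequence in the compactification to
    the same sequence \<open>f \<circ> z\<close> in \<open>X\<close>, so the values of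
    \<open>g\<close> and \<open>h\<close> at \<open>None\<close> are limits of one sequence.\<close>
  have "transfinite_limit X r (f \<circ> z) (k None)"
    if k: "continuous_map (Alexandroff_compactification L) X k"
      and kf: "\<forall>z\<in>topspace L. k (Some z) = f z" for k
    by (rule transfinite_limit_cong[OF transfinite_limit_continuous_map[OF k lim]])
      (simp add: kf z)
  moreover have "transfinite_seq X r (f \<circ> z)"
    using seq f unfolding transfinite_seq_def continuous_map_def by auto
  ultimately have "g None = h None"
    using UR g h gf hf unfolding UR_def by blast
  \<comment> \<open>At the points \<open>Some p\<close> both maps equal \<open>f p\<close>, so only
    \<open>None\<close> was in question.\<close>
  then show "g w = h w"
    using w gf hf by auto
qed

theorem theorem4p3:
  fixes X :: "'a topology"
  shows "(Hausdorff_space X \<longrightarrow> UR TYPE('i) X) \<and>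
         (UR TYPE('a + nat) X \<longrightarrow> UOK TYPE('l) X)"
  \<comment> \<open>\<open>UR_type_independent\<close> carries the property from
    \<open>'a + nat\<close> to \<open>'l set\<close>, the index type required by
    \<open>UR_imp_UOK\<close>.\<close>
  using Hausdorff_space_imp_UR UR_imp_UOK UR_type_independent by blast

end
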